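(* Let $n\ge3$ and let $R_n$ be the linear hexagonal cylinder chain with vertices $p_i,q_i,u_i,v_i$, $i\in\{1,\dots,n\}$ (indices modulo $n$) and edges $p_iq_i$, $p_iu_i$, $u_ip_{i+1}$, $q_iv_i$, $v_iq_{i+1}$ ($1\le i\le n$); let $r$ denote resistance distance in $R_n$. Then for any two distinct vertices $a,b$ of $R_n$, $$r(u_1,v_{\lfloor\frac{n+2}{2}\rfloor})\ge r(a,b)\ge r(p_1,q_1).$$
   Context: The resistance distance $r(a,b)$ is the effective resistance between $a$ and $b$ when each edge is a unit resistor. *)

theory Defs
  imports Complex_Main
begin

text \<open>
  A simple graph is given by a vertex set \<open>V\<close> and a set \<open>E\<close> of undirected edges
  \<open>{x, y}\<close>. With unit resistors, Ohm's law says that the current flowing from \<open>x\<close> to a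
  neighbour \<open>y\<close> is the potential difference \<open>\<phi> x - \<phi> y\<close>. The predicate below is Kirchhoff's
  current law when one unit of current enters at \<open>a\<close> and leaves at \<open>b\<close>.
\<close>

definition unit_current_potential ::
    "'a set \<Rightarrow> 'a set set \<Rightarrow> 'a \<Rightarrow> 'a \<Rightarrow> ('a \<Rightarrow> real) \<Rightarrow> bool" where
  "unit_current_potential V E a b \<phi> \<longleftrightarrow>
     (\<forall>x\<in>V. (\<Sum>y\<in>{y\<in>V. {x, y} \<in> E}. \<phi> x - \<phi> y) =
        (if x = a then 1 else 0) - (if x = b then 1 else 0))"

text \<open>
  The effective resistance is the voltage between \<open>a\<close> and \<open>b\<close> under a unit current. Its
  value does not depend on the potential chosen (lemma \<open>resistance_distance_eqI\<close>); a
  potential exists whenever the finite graph is connected.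
\<close>

definition resistance_distance :: "'a set \<Rightarrow> 'a set set \<Rightarrow> 'a \<Rightarrow> 'a \<Rightarrow> real" where
  "resistance_distance V E a b =
     (THE r. \<exists>\<phi>. unit_current_potential V E a b \<phi> \<and> r = \<phi> a - \<phi> b)"

lemma laplacian_symmetric:
  fixes \<phi> \<psi> :: "'a \<Rightarrow> real"
  assumes "finite V"
  shows "(\<Sum>x\<in>V. \<psi> x * (\<Sum>y\<in>{y\<in>V. {x, y} \<in> E}. \<phi> x - \<phi> y)) =
         (\<Sum>x\<in>V. \<phi> x * (\<Sum>y\<in>{y\<in>V. {x, y} \<in> E}. \<psi> x - \<psi> y))"
proof -
  define w :: "'a \<Rightarrow> 'a \<Rightarrow> real" where "w x y = (if {x, y} \<in> E then 1 else 0)" for x y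
  have w_sym: "w x y = w y x" for x y
    by (simp add: w_def insert_commute)
  have lap: "(\<Sum>y\<in>{y\<in>V. {x, y} \<in> E}. f x - f y) = (\<Sum>y\<in>V. w x y * (f x - f y))"
    for f :: "'a \<Rightarrow> real" and x
    using assms by (auto simp: w_def sum.inter_filter intro!: sum.cong)
  have expand: "(\<Sum>x\<in>V. g x * (\<Sum>y\<in>V. w x y * (f x - f y))) =
      (\<Sum>x\<in>V. \<Sum>y\<in>V. w x y * f x * g x) - (\<Sum>x\<in>V. \<Sum>y\<in>V. w x y * g x * f y)"
    for f g :: "'a \<Rightarrow> real"
    by (simp add: sum_distrib_left sum_subtractf[symmetric] algebra_simps)
  have "(\<Sum>x\<in>V. \<Sum>y\<in>V. w x y * \<psi> x * \<phi> y) = (\<Sum>x\<in>V. \<Sum>y\<in>V. w x y * \<phi> x * \<psi> y)"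
    by (subst sum.swap) (simp add: w_sym mult.commute mult.left_commute)
  then show ?thesis
    by (simp add: lap expand mult.commute mult.left_commute)
qed

lemma unit_current_potential_pairing:
  assumes "finite V" "a \<in> V" "b \<in> V" "unit_current_potential V E a b \<phi>"
  shows "(\<Sum>x\<in>V. \<psi> x * (\<Sum>y\<in>{y\<in>V. {x, y} \<in> E}. \<phi> x - \<phi> y)) = \<psi> a - \<psi> b"
proof -
  have "(\<Sum>x\<in>V. \<psi> x * (\<Sum>y\<in>{y\<in>V. {x, y} \<in> E}. \<phi> x - \<phi> y)) =
      (\<Sum>x\<in>V. (if x = a then \<psi> x else 0) - (if x = b then \<psi> x else 0))"
    using assms(4) by (intro sum.cong) (auto simp: unit_current_potential_def)
  also have "\<dots> = \<psi> a - \<psi> b"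
    using assms by (simp add: sum_subtractf)
  finally show ?thesis .
qed

lemma resistance_distance_eqI:
  assumes "finite V" "a \<in> V" "b \<in> V" "unit_current_potential V E a b \<phi>"
  shows "resistance_distance V E a b = \<phi> a - \<phi> b"
  unfolding resistance_distance_def
proof (rule the_equality)
  show "\<exists>\<phi>'. unit_current_potential V E a b \<phi>' \<and> \<phi> a - \<phi> b = \<phi>' a - \<phi>' b"
    using assms(4) by blast
next
  fix r assume "\<exists>\<psi>. unit_current_potential V E a b \<psi> \<and> r = \<psi> a - \<psi> b"
  then obtain \<psi> where psi: "unit_current_potential V E a b \<psi>" and r: "r = \<psi> a - \<psi> b"
    by blast
  show "r = \<phi> a - \<phi> b"
    using laplacian_symmetric[OF assms(1), where E = E and \<phi> = \<phi> and \<psi> = \<psi>]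
      unit_current_potential_pairing[OF assms, where \<psi> = \<psi>]
      unit_current_potential_pairing[OF assms(1-3) psi, where \<psi> = \<phi>] r
    by simp
qed

datatype hex_vertex = P nat | Q nat | U nat | V nat

definition hex_cylinder_verts :: "nat \<Rightarrow> hex_vertex set" where
  "hex_cylinder_verts n = P ` {1..n} \<union> Q ` {1..n} \<union> U ` {1..n} \<union> V ` {1..n}"

text \<open>For \<open>i \<in> {1..n}\<close> the term \<open>i mod n + 1\<close> is the index \<open>i + 1\<close> modulo \<open>n\<close>, taken in
  \<open>{1..n}\<close>.\<close>

definition hex_cylinder_edges :: "nat \<Rightarrow> hex_vertex set set" where
  "hex_cylinder_edges n =
     (\<Union>i\<in>{1..n}. {{P i, Q i}, {P i, U i}, {U i, P (i mod n + 1)},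
                      {Q i, V i}, {V i, Q (i mod n + 1)}})"

definition hex_cylinder_resistance :: "nat \<Rightarrow> hex_vertex \<Rightarrow> hex_vertex \<Rightarrow> real" where
  "hex_cylinder_resistance n =
     resistance_distance (hex_cylinder_verts n) (hex_cylinder_edges n)"

end

(* Identify R_n with two copies of the cycle Z/2n, the cells P i, U i of one copy sitting at 2i, 2i+1.
   Under the reflection exchanging the copies, the Laplacian splits into a symmetric part, the
   Laplacian of the cycle, and an antisymmetric part, in which every P-vertex is grounded through
   conductance 2. With weights 1 on P and sqrt 2 on U the latter becomes translation invariant with
   characteristic equation x^2 - 2 sqrt 2 x + 1 = 0, so its Green function is w_x w_y gamma(t) with
   gamma(t) proportional to q^t + q^(2n-t), q = sqrt 2 - 1. Hence, with c(t) = t (2n - t) / (2n),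
     2 r(x, y) = c(t) + (w_x^2 + w_y^2) gamma(0) -/+ 2 w_x w_y gamma(t),
   with the sign + when x and y lie on different copies. Everything then follows from
   1/3 <= gamma(0) <= 5/14, gamma(2d) <= 1/14 off the diagonal, and the fact that
   c(2d) + 4 gamma(2d) increases for 0 <= d <= n/2; odd distances t are averages of t - 1 and t + 1. *)

theory Submission
  imports Defs
begin

section \<open>Functions on the cycle Z/N, given by a profile on residues\<close>

definition cyclic :: "nat \<Rightarrow> (nat \<Rightarrow> real) \<Rightarrow> int \<Rightarrow> real" where
  "cyclic N e t = e (nat (t mod int N))"

lemma cyclic_nat: "m < N \<Longrightarrow> cyclic N e (int m) = e m"
  by (simp add: cyclic_def nat_mod_distrib)

lemma cyclic_cong: "s mod int N = t mod int N \<Longrightarrow> cyclic N e s = cyclic N e t"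
  by (simp add: cyclic_def)

lemma cyclic_minus:
  assumes "0 < N" "\<And>m. m \<le> N \<Longrightarrow> e (N - m) = e m"
  shows "cyclic N e (- t) = cyclic N e t"
proof -
  define m where "m = nat (t mod int N)"
  have m: "t mod int N = int m" "m < N"
    using assms(1) by (auto simp: m_def nat_less_iff)
  \<comment> \<open>Residue 0 is its own negative, whereas \<open>N - 0\<close> is not a residue;
    the symmetry of \<open>e\<close> at \<open>m = 0\<close> covers this case.\<close>
  have "nat ((- t) mod int N) = (if m = 0 then 0 else N - m)"
    using m by (auto simp: zmod_zminus1_eq_if)
  then show ?thesis
    using assms(2)[of m] m by (simp add: cyclic_def)
qed

text \<open>Since \<open>e N = e 0\<close>, the wrap-around at residue N - 1 is invisible and the
  successor needs no case distinction.\<close>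

lemma cyclic_Suc:
  assumes "0 < N" "e N = e 0"
  shows "cyclic N e (t + 1) = e (Suc (nat (t mod int N)))"
proof -
  define m where "m = nat (t mod int N)"
  have m: "t mod int N = int m" "m < N"
    using assms(1) by (auto simp: m_def nat_less_iff)
  have "(t + 1) mod int N = (int m + 1) mod int N"
    using m by (metis mod_add_left_eq)
  also have "\<dots> = (if Suc m = N then 0 else int m + 1)"
    using m by (auto simp: add.commute)
  finally show ?thesis
    using assms m by (auto simp: cyclic_def nat_add_distrib)
qed

lemma cyclic_pred:
  assumes "0 < N"
  shows "cyclic N e (t - 1) = e (if int N dvd t then N - 1 else nat (t mod int N) - 1)"
proof -
  define m where "m = nat (t mod int N)"
  have m: "t mod int N = int m" "m < N"
    using assms(1) by (auto simp: m_def nat_less_iff)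
  have dvd: "int N dvd t \<longleftrightarrow> m = 0"
    using m by (simp add: dvd_eq_mod_eq_0)
  have "(t - 1) mod int N = (int m - 1) mod int N"
    using m by (metis mod_diff_left_eq)
  also have "\<dots> = (if m = 0 then int N - 1 else int m - 1)"
    using m by (auto simp: zmod_minus1)
  finally show ?thesis
    using m dvd by (auto simp: cyclic_def nat_diff_distrib)
qed

section \<open>Resistance and damped Green function on the cycle Z/2n\<close>

lemma double_mod_cases:
  fixes t :: int
  assumes "0 < n"
  obtains m where "t mod (2 * int n) = int m" "m < 2 * n" "2 * int n dvd t \<longleftrightarrow> m = 0" "even t \<longleftrightarrow> even m"
proof
  let ?m = "nat (t mod (2 * int n))"
  have bounds: "t mod (2 * int n) \<ge> 0" "t mod (2 * int n) < 2 * int n"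
    using assms by auto
  then show m: "t mod (2 * int n) = int ?m"
    by simp
  show "?m < 2 * n"
    using bounds by linarith
  show "2 * int n dvd t \<longleftrightarrow> ?m = 0"
    unfolding dvd_eq_mod_eq_0 using m by linarith
  have "even t \<longleftrightarrow> even (t mod (2 * int n))"
    by (subst dvd_mod_iff) auto
  then show "even t \<longleftrightarrow> even ?m"
    using bounds by (simp only: even_nat_iff)
qed

text \<open>Resistance of two arcs of lengths m and 2n - m in parallel, on a cycle of 2n unit
  resistors.\<close>

definition cycle_resistance :: "nat \<Rightarrow> int \<Rightarrow> real" where
  "cycle_resistance n = cyclic (2 * n) (\<lambda>m. real m * (2 * real n - real m) / (2 * real n))"

text \<open>With q = sqrt 2 - 1, this is the periodization of q^|t| / (2 sqrt 2): summing over all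
  translates by 2n gives two geometric series, hence the factor 1 - q^(2n). The constant 2 sqrt 2
  gives the source at 0 strength 1 / sqrt 2.\<close>

definition damped_profile :: "nat \<Rightarrow> nat \<Rightarrow> real" where
  "damped_profile n m =
     ((sqrt 2 - 1) ^ m + (sqrt 2 - 1) ^ (2 * n - m)) / (2 * sqrt 2 * (1 - (sqrt 2 - 1) ^ (2 * n)))"

definition damped_green :: "nat \<Rightarrow> int \<Rightarrow> real" where
  "damped_green n = cyclic (2 * n) (damped_profile n)"

text \<open>A parabola has constant second difference; the periodic extension adds a corner at the
  multiples of 2n.\<close>

lemma cycle_resistance_second_difference:
  assumes "0 < n"
  shows "2 * cycle_resistance n t - cycle_resistance n (t - 1) - cycle_resistance n (t + 1)
    = 1 / n - (if 2 * int n dvd t then 2 else 0)"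
proof -
  obtain m where m: "t mod (2 * int n) = int m" "m < 2 * n" "2 * int n dvd t \<longleftrightarrow> m = 0" "even t \<longleftrightarrow> even m"
    by (rule double_mod_cases[of n t]) (use assms in auto)
  show ?thesis
    using m assms
    unfolding cycle_resistance_def
    by (subst cyclic_Suc, simp, simp, subst cyclic_pred, simp)
      (auto simp: cyclic_def of_nat_diff field_simps)
qed

lemma root_bounds: "0 < sqrt 2 - (1::real)" "sqrt 2 - (1::real) < 1"
  by (auto intro: real_less_lsqrt)

lemma damped_denominator_pos:
  assumes "0 < n"
  shows "0 < 2 * sqrt 2 * (1 - (sqrt 2 - 1 :: real) ^ (2 * n))"
  using power_Suc_less_one[OF root_bounds, of "2 * n - 1"] assms by simp

text \<open>\<open>sqrt 2 - 1\<close> and its inverse \<open>sqrt 2 + 1\<close> are the roots of \<open>x\<^sup>2 - 2 sqrt 2 x + 1\<close>.\<close>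

lemma root_recurrence:
  "2 * sqrt 2 * (sqrt 2 - 1) ^ Suc k = (sqrt 2 - 1) ^ k + (sqrt 2 - 1 :: real) ^ Suc (Suc k)"
proof -
  have "2 * sqrt 2 * (sqrt 2 - 1) = 1 + (sqrt 2 - 1 :: real)\<^sup>2"
    by (simp add: power2_eq_square algebra_simps)
  then have "(sqrt 2 - 1) ^ k * (2 * sqrt 2 * (sqrt 2 - 1)) = (sqrt 2 - 1) ^ k * (1 + (sqrt 2 - 1 :: real)\<^sup>2)"
    by simp
  then show ?thesis
    by (simp add: power2_eq_square distrib_left mult_ac)
qed

lemma damped_profile_recurrence:
  assumes "0 < m" "m < 2 * n"
  shows "2 * sqrt 2 * damped_profile n m = damped_profile n (m - 1) + damped_profile n (m + 1)"
proof -
  obtain k where k: "m = Suc k"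
    using assms by (auto simp: gr0_conv_Suc)
  obtain l where l: "2 * n - m = Suc l"
    using assms by (metis Suc_diff_Suc)
  have "2 * n - k = Suc (Suc l)" "2 * n - Suc (Suc k) = l"
    using k l by auto
  then show ?thesis
    using root_recurrence[of k] root_recurrence[of l] k l
    unfolding damped_profile_def
    by (simp add: add_divide_distrib[symmetric] distrib_left add_ac del: power_Suc)
qed

lemma damped_profile_0:
  assumes "0 < n"
  shows "2 * sqrt 2 * damped_profile n 0 - 2 * damped_profile n 1 = 1 / sqrt 2"
proof -
  define q :: real where "q = sqrt 2 - 1"
  obtain k where k: "2 * n = Suc k"
    using assms by (metis Suc_pred nat_0_less_mult_iff zero_less_numeral)
  have qq: "q * (sqrt 2 + 1) = 1"
    by (simp add: q_def algebra_simps)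
  \<comment> \<open>Dividing by q is multiplying by sqrt 2 + 1, so the neighbour 2n - 1 of 0 is
    expressed through q^(2n).\<close>
  then have qk: "q ^ k = q ^ (2 * n) * (sqrt 2 + 1)"
    unfolding k by (simp add: mult_ac)
  have "2 * sqrt 2 * (1 + q ^ (2 * n)) - 2 * (q + q ^ k) = 2 * (1 - q ^ (2 * n))"
    unfolding qk by (simp add: q_def algebra_simps)
  moreover have "1 - q ^ (2 * n) \<noteq> 0"
    using damped_denominator_pos[OF assms] by (auto simp: q_def)
  ultimately have "(2 * sqrt 2 * (1 + q ^ (2 * n)) - 2 * (q + q ^ k)) / (2 * sqrt 2 * (1 - q ^ (2 * n)))
      = 1 / sqrt 2"
    by (simp only: nonzero_mult_divide_mult_cancel_right mult.assoc mult_divide_mult_cancel_left_if) simp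
  moreover have "2 * n - 1 = k"
    using k by simp
  ultimately show ?thesis
    unfolding damped_profile_def q_def[symmetric]
    by (simp add: diff_divide_distrib)
qed

lemma damped_profile_reflect: "m \<le> 2 * n \<Longrightarrow> damped_profile n (2 * n - m) = damped_profile n m"
  by (simp add: damped_profile_def add.commute)

lemma damped_profile_nonneg: "0 < n \<Longrightarrow> 0 \<le> damped_profile n m"
  unfolding damped_profile_def
  using damped_denominator_pos[of n] root_bounds
  by (intro divide_nonneg_pos add_nonneg_nonneg zero_le_power) auto

text \<open>The difference of the numerators factors as q^k (1 - q^i) (1 - q^j) with i = m - k and j
  = 2n - m - k.\<close>

lemma damped_profile_le:
  assumes "k \<le> m" "m + k \<le> 2 * n" "0 < n"
  shows "damped_profile n m \<le> damped_profile n k"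
proof -
  define q :: real where "q = sqrt 2 - 1"
  have q: "0 \<le> q" "q \<le> 1"
    using root_bounds by (auto simp: q_def)
  define i j where "i = m - k" and "j = 2 * n - m - k"
  have eqs: "m = k + i" "2 * n - m = k + j" "2 * n - k = k + i + j"
    using assms by (auto simp: i_def j_def)
  have "0 \<le> q ^ k * ((1 - q ^ i) * (1 - q ^ j))"
    using q by (intro mult_nonneg_nonneg) (auto simp: power_le_one)
  then have "q ^ m + q ^ (2 * n - m) \<le> q ^ k + q ^ (2 * n - k)"
    unfolding eqs(2,3) unfolding eqs(1) by (simp add: power_add algebra_simps)
  then show ?thesis
    unfolding damped_profile_def q_def[symmetric]
    using damped_denominator_pos[OF assms(3)] by (intro divide_right_mono) (auto simp: q_def)
qed

lemma damped_green_recurrence: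
  assumes "0 < n"
  shows "2 * sqrt 2 * damped_green n t - damped_green n (t - 1) - damped_green n (t + 1)
    = (if 2 * int n dvd t then 1 / sqrt 2 else 0)"
proof -
  obtain m where m: "t mod (2 * int n) = int m" "m < 2 * n" "2 * int n dvd t \<longleftrightarrow> m = 0" "even t \<longleftrightarrow> even m"
    by (rule double_mod_cases[of n t]) (use assms in auto)
  have "damped_profile n (2 * n) = damped_profile n 0"
    using damped_profile_reflect[of 0 n] by simp
  moreover have "damped_profile n (2 * n - 1) = damped_profile n 1"
    using damped_profile_reflect[of 1 n] assms by simp
  ultimately show ?thesis
    using m assms damped_profile_0[OF assms] damped_profile_recurrence[of m n]
    unfolding damped_green_def
    by (subst cyclic_Suc, simp, simp, subst cyclic_pred, simp) (auto simp: cyclic_def)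
qed

lemma damped_green_minus: "0 < n \<Longrightarrow> damped_green n (- t) = damped_green n t"
  unfolding damped_green_def by (rule cyclic_minus) (auto simp: damped_profile_reflect)

lemma cycle_resistance_minus: "0 < n \<Longrightarrow> cycle_resistance n (- t) = cycle_resistance n t"
  unfolding cycle_resistance_def by (rule cyclic_minus) (auto simp: of_nat_diff)

lemma damped_green_nonneg: "0 < n \<Longrightarrow> 0 \<le> damped_green n t"
  by (simp add: damped_green_def cyclic_def damped_profile_nonneg)

lemma cycle_resistance_0: "cycle_resistance n 0 = 0"
  by (simp add: cycle_resistance_def cyclic_def)

section \<open>The Green function of the hexagonal cylinder\<close>

fun pos :: "hex_vertex \<Rightarrow> int" where
  "pos (P i) = 2 * int i"
| "pos (Q i) = 2 * int i"
| "pos (U i) = 2 * int i + 1"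
| "pos (V i) = 2 * int i + 1"

fun side :: "hex_vertex \<Rightarrow> real" where
  "side (P i) = 1"
| "side (Q i) = - 1"
| "side (U i) = 1"
| "side (V i) = - 1"

fun weight :: "hex_vertex \<Rightarrow> real" where
  "weight (P i) = 1"
| "weight (Q i) = 1"
| "weight (U i) = sqrt 2"
| "weight (V i) = sqrt 2"

text \<open>The outer 1/2 comes from projecting onto the symmetric and antisymmetric parts. On the
  symmetric part, -c/2 inverts the Laplacian of the cycle up to constants.\<close>

definition green :: "nat \<Rightarrow> hex_vertex \<Rightarrow> hex_vertex \<Rightarrow> real" where
  "green n x y = (side x * side y * weight x * weight y * damped_green n (pos x - pos y)
     - cycle_resistance n (pos x - pos y) / 2) / 2"

definition pred_index :: "nat \<Rightarrow> nat \<Rightarrow> nat" where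
  "pred_index n i = (if i = 1 then n else i - 1)"

lemma pred_index_bounds:
  "i \<in> {1..n} \<Longrightarrow> pred_index n i \<in> {1..n}"
  by (auto simp: pred_index_def)

lemma succ_index_bounds:
  "i \<in> {1..n} \<Longrightarrow> i mod n + 1 \<in> {1..n}" for i n :: nat
  using mod_less_divisor[of n i] by (auto simp: Suc_le_eq)

lemma succ_index_eq_iff:
  assumes "i \<in> {1..n}" "j \<in> {1..n}"
  shows "i = j mod n + 1 \<longleftrightarrow> j = pred_index n i"
  using assms by (cases "j = n") (auto simp: pred_index_def)

text \<open>Ensures that the neighbour sets below have as many elements as they list, so that sums
  over them expand term by term.\<close>

lemma index_neq:
  assumes "n \<ge> 3" "i \<in> {1..n}"
  shows "pred_index n i \<noteq> i" "i mod n + 1 \<noteq> i"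
  using assms by (cases "i = n"; auto simp: pred_index_def)+

lemma hex_cylinder_edges_iff:
  "{P i, y} \<in> hex_cylinder_edges n \<longleftrightarrow>
     (i \<in> {1..n} \<and> (y = Q i \<or> y = U i)) \<or> (\<exists>j\<in>{1..n}. y = U j \<and> i = j mod n + 1)"
  "{Q i, y} \<in> hex_cylinder_edges n \<longleftrightarrow>
     (i \<in> {1..n} \<and> (y = P i \<or> y = V i)) \<or> (\<exists>j\<in>{1..n}. y = V j \<and> i = j mod n + 1)"
  "{U i, y} \<in> hex_cylinder_edges n \<longleftrightarrow> i \<in> {1..n} \<and> (y = P i \<or> y = P (i mod n + 1))"
  "{V i, y} \<in> hex_cylinder_edges n \<longleftrightarrow> i \<in> {1..n} \<and> (y = Q i \<or> y = Q (i mod n + 1))"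
  unfolding hex_cylinder_edges_def by (cases y; auto simp: doubleton_eq_iff)+

lemma neighbours:
  assumes "i \<in> {1..n}"
  shows "{y \<in> hex_cylinder_verts n. {P i, y} \<in> hex_cylinder_edges n} = {Q i, U i, U (pred_index n i)}"
    and "{y \<in> hex_cylinder_verts n. {Q i, y} \<in> hex_cylinder_edges n} = {P i, V i, V (pred_index n i)}"
    and "{y \<in> hex_cylinder_verts n. {U i, y} \<in> hex_cylinder_edges n} = {P i, P (i mod n + 1)}"
    and "{y \<in> hex_cylinder_verts n. {V i, y} \<in> hex_cylinder_edges n} = {Q i, Q (i mod n + 1)}"
  unfolding hex_cylinder_edges_iff hex_cylinder_verts_def
  using assms pred_index_bounds[OF assms] succ_index_bounds[OF assms] succ_index_eq_iff[OF assms]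
  by blast+

lemma green_cong:
  assumes "side x = side x'" "weight x = weight x'" "pos x mod int (2 * n) = pos x' mod int (2 * n)"
  shows "green n x y = green n x' y"
  using assms cyclic_cong[OF mod_diff_cong[OF assms(3) refl, of "pos y"]]
  by (simp add: green_def damped_green_def cycle_resistance_def)

text \<open>Replaces the wrapped index by plain \<open>i - 1\<close>. For i = 1 this names
  \<open>U 0\<close> or \<open>V 0\<close>, which is no vertex but has the right position modulo
  2n.\<close>

lemma green_pred_index:
  assumes "i \<in> {1..n}"
  shows "green n (U (pred_index n i)) y = green n (U (i - 1)) y"
    and "green n (V (pred_index n i)) y = green n (V (i - 1)) y"
  using assms by (auto simp: pred_index_def intro!: green_cong)

lemma green_succ_index:
  assumes "i \<in> {1..n}"
  shows "green n (P (Suc (i mod n))) y = green n (P (Suc i)) y"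
    and "green n (Q (Suc (i mod n))) y = green n (Q (Suc i)) y"
  using assms by (cases "i = n"; auto intro!: green_cong)+

text \<open>Vertex positions range over 2, ..., 2n + 1, exactly one period.\<close>

lemma dvd_pos_diff_iff:
  assumes "x \<in> hex_cylinder_verts n" "y \<in> hex_cylinder_verts n"
  shows "2 * int n dvd pos x - pos y \<longleftrightarrow> pos x = pos y"
proof
  assume dvd: "2 * int n dvd pos x - pos y"
  have "\<bar>pos x - pos y\<bar> < 2 * int n"
    using assms by (auto simp: hex_cylinder_verts_def)
  then show "pos x = pos y"
    using dvd zdvd_not_zless[of "\<bar>pos x - pos y\<bar>" "2 * int n"] by fastforce
qed simp

text \<open>A Laplacian sums to zero over the graph, so the unit source is balanced by a uniform
  sink 1 / (4n) on the 4n vertices. This sink cancels in the difference of two Green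
  functions.\<close>

lemma green_laplacian:
  assumes n: "n \<ge> 3" and x: "x \<in> hex_cylinder_verts n" and y: "y \<in> hex_cylinder_verts n"
  shows "(\<Sum>z\<in>{z \<in> hex_cylinder_verts n. {x, z} \<in> hex_cylinder_edges n}. green n x y - green n z y)
    = (if x = y then 1 else 0) - 1 / (4 * n)"
proof -
  define t where "t = pos x - pos y"
  define g g1 g2 where "g = damped_green n t" and "g1 = damped_green n (t - 1)"
    and "g2 = damped_green n (t + 1)"
  define c c1 c2 where "c = cycle_resistance n t" and "c1 = cycle_resistance n (t - 1)"
    and "c2 = cycle_resistance n (t + 1)"
  define \<delta> :: real where "\<delta> = (if pos x = pos y then 1 else 0)"
  have dvd: "2 * int n dvd t \<longleftrightarrow> pos x = pos y"
    using dvd_pos_diff_iff[OF x y] by (simp add: t_def)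
  have g_eq: "2 * sqrt 2 * g - g1 - g2 = \<delta> / sqrt 2"
    using damped_green_recurrence[of n t] n dvd by (simp add: g_def g1_def g2_def \<delta>_def)
  have c_eq: "2 * c - c1 - c2 = 1 / n - 2 * \<delta>"
    using cycle_resistance_second_difference[of n t] n dvd by (simp add: c_def c1_def c2_def \<delta>_def)
  \<comment> \<open>The equation at a P- or Q-vertex: degree 3, plus 1 because the rung leads to the
    opposite sign, and two neighbours of weight sqrt 2.\<close>
  have g_eq': "4 * g - sqrt 2 * g1 - sqrt 2 * g2 = \<delta>"
  proof -
    have "sqrt 2 * (2 * sqrt 2 * g - g1 - g2) = sqrt 2 * (\<delta> / sqrt 2)"
      unfolding g_eq by simp
    then show ?thesis
      by (simp add: algebra_simps)
  qed
  have delta: "(if x = y then 1 else 0) = (1 + side x * side y) / 2 * \<delta>"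
    using x y by (cases x; cases y) (auto simp: \<delta>_def, presburger+)
  \<comment> \<open>Equal positions have equal parity, and parity determines the weight.\<close>
  have weight: "\<delta> * weight y = \<delta> * weight x"
    by (cases x; cases y) (auto simp: \<delta>_def, presburger+)
  have green_shift: "green n z y = (side z * side y * weight z * weight y * damped_green n (t + e)
      - cycle_resistance n (t + e) / 2) / 2" if "pos z = pos x + e" for z e
  proof -
    have "pos z - pos y = t + e"
      using that by (simp add: t_def)
    then show ?thesis
      by (simp add: green_def)
  qed
  note green_at = green_shift[of _ 0, unfolded add_0_right, folded g_def c_def]
    and green_below = green_shift[of _ "- 1", unfolded add_uminus_conv_diff, folded g1_def c1_def]
    and green_above = green_shift[of _ 1, folded g2_def c2_def]
  \<comment> \<open>The antisymmetric Laplacian at x without the factors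
    \<open>side x * side y * weight y\<close>: first at degree 3, then at degree 2.\<close>
  define g' where "g' = (if weight x = 1 then 4 * g - sqrt 2 * g1 - sqrt 2 * g2 else 2 * sqrt 2 * g - g1 - g2)"
  have sum_eq: "(\<Sum>z\<in>{z \<in> hex_cylinder_verts n. {x, z} \<in> hex_cylinder_edges n}. green n x y - green n z y)
    = (side x * side y * weight y * g' - (2 * c - c1 - c2) / 2) / 2"
  proof (cases x)
    case (P i)
    then have i: "i \<in> {1..n}"
      using x by (auto simp: hex_cylinder_verts_def)
    show ?thesis
      using i index_neq[OF n i] unfolding P neighbours(1)[OF i]
      by (simp add: green_pred_index[OF i] green_succ_index[OF i] green_at green_below green_above g'_def
          of_nat_diff P diff_divide_distrib add_divide_distrib algebra_simps)
  next
    case (Q i)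
    then have i: "i \<in> {1..n}"
      using x by (auto simp: hex_cylinder_verts_def)
    show ?thesis
      using i index_neq[OF n i] unfolding Q neighbours(2)[OF i]
      by (simp add: green_pred_index[OF i] green_succ_index[OF i] green_at green_below green_above g'_def
          of_nat_diff Q diff_divide_distrib add_divide_distrib algebra_simps)
  next
    case (U i)
    then have i: "i \<in> {1..n}"
      using x by (auto simp: hex_cylinder_verts_def)
    show ?thesis
      using i index_neq[OF n i] unfolding U neighbours(3)[OF i]
      by (simp add: green_pred_index[OF i] green_succ_index[OF i] green_at green_below green_above g'_def
          of_nat_diff U diff_divide_distrib add_divide_distrib algebra_simps)
  next
    case (V i)
    then have i: "i \<in> {1..n}"
      using x by (auto simp: hex_cylinder_verts_def)
    show ?thesis
      using i index_neq[OF n i] unfolding V neighbours(4)[OF i]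
      by (simp add: green_pred_index[OF i] green_succ_index[OF i] green_at green_below green_above g'_def
          of_nat_diff V diff_divide_distrib add_divide_distrib algebra_simps)
  qed
  have "weight x * g' = \<delta>"
    using g_eq g_eq' by (cases x) (simp_all add: g'_def)
  moreover have "weight x \<noteq> 0"
    by (cases x) simp_all
  ultimately have "weight y * g' = \<delta>"
    using weight by (metis mult.assoc mult.commute mult_left_cancel)
  then have "side x * side y * weight y * g' = side x * side y * \<delta>"
    by (simp add: mult.assoc)
  then show ?thesis
    unfolding sum_eq delta c_eq by (simp add: field_simps)
qed

lemma green_diff_potential:
  assumes "n \<ge> 3" "a \<in> hex_cylinder_verts n" "b \<in> hex_cylinder_verts n"
  shows "unit_current_potential (hex_cylinder_verts n) (hex_cylinder_edges n) a b
    (\<lambda>x. green n x a - green n x b)"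
  unfolding unit_current_potential_def
proof
  fix x assume x: "x \<in> hex_cylinder_verts n"
  let ?N = "{z \<in> hex_cylinder_verts n. {x, z} \<in> hex_cylinder_edges n}"
  have "(\<Sum>z\<in>?N. green n x a - green n x b - (green n z a - green n z b)) =
      (\<Sum>z\<in>?N. green n x a - green n z a) - (\<Sum>z\<in>?N. green n x b - green n z b)"
    by (simp add: sum_subtractf[symmetric] algebra_simps)
  then show "(\<Sum>z\<in>?N. green n x a - green n x b - (green n z a - green n z b)) =
      (if x = a then 1 else 0) - (if x = b then 1 else 0)"
    using green_laplacian[OF assms(1) x assms(2)] green_laplacian[OF assms(1) x assms(3)] by simp
qed

lemma hex_cylinder_resistance_eq:
  assumes "n \<ge> 3" "a \<in> hex_cylinder_verts n" "b \<in> hex_cylinder_verts n"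
  shows "2 * hex_cylinder_resistance n a b =
    cycle_resistance n (pos a - pos b) + ((weight a)\<^sup>2 + (weight b)\<^sup>2) * damped_green n 0
    - 2 * side a * side b * weight a * weight b * damped_green n (pos a - pos b)"
proof -
  have "finite (hex_cylinder_verts n)"
    by (simp add: hex_cylinder_verts_def)
  then have "hex_cylinder_resistance n a b = green n a a - green n a b - (green n b a - green n b b)"
    unfolding hex_cylinder_resistance_def
    using resistance_distance_eqI[OF _ assms(2,3) green_diff_potential[OF assms]] by simp
  moreover have "side a * side a = 1" "side b * side b = 1"
    by (cases a; simp) (cases b; simp)
  moreover have "damped_green n (pos b - pos a) = damped_green n (pos a - pos b)"
    "cycle_resistance n (pos b - pos a) = cycle_resistance n (pos a - pos b)"
    using assms(1) damped_green_minus[of n "pos a - pos b"] cycle_resistance_minus[of n "pos a - pos b"]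
    by auto
  ultimately show ?thesis
    by (simp add: green_def cycle_resistance_0 power2_eq_square algebra_simps)
qed

section \<open>Bounds on gamma, c and c + 4 gamma\<close>

text \<open>Eliminating the odd neighbours, which carry no source, removes sqrt 2 and leaves a
  recurrence with integer coefficients.\<close>

lemma damped_green_even_recurrence:
  assumes "0 < n" "even t"
  shows "6 * damped_green n t - damped_green n (t - 2) - damped_green n (t + 2)
    = (if 2 * int n dvd t then 2 else 0)"
proof -
  have odd: "\<not> 2 * int n dvd t - 1" "\<not> 2 * int n dvd t + 1"
    using assms(2) by (meson dvd_mult_left even_add even_diff odd_one dvd_trans)+
  define a1 a2 where "a1 = sqrt 2 * damped_green n (t - 1)" and "a2 = sqrt 2 * damped_green n (t + 1)"
  have "sqrt 2 * (2 * sqrt 2 * damped_green n t - damped_green n (t - 1) - damped_green n (t + 1)) =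
    (if 2 * int n dvd t then 1 else 0)"
    unfolding damped_green_recurrence[OF assms(1)] by simp
  moreover have "sqrt 2 * (2 * sqrt 2 * damped_green n t) = 4 * damped_green n t"
    by simp
  ultimately have "4 * damped_green n t - a1 - a2 = (if 2 * int n dvd t then 1 else 0)"
    by (simp only: right_diff_distrib a1_def a2_def)
  moreover have "2 * a1 = damped_green n (t - 2) + damped_green n t"
    using damped_green_recurrence[OF assms(1), of "t - 1"] odd by (simp add: a1_def)
  moreover have "2 * a2 = damped_green n t + damped_green n (t + 2)"
    using damped_green_recurrence[OF assms(1), of "t + 1"] odd by (simp add: a2_def add.commute)
  ultimately show ?thesis
    by (simp split: if_splits)
qed

lemma damped_green_le_max:
  assumes "0 < n"
  shows "damped_green n t \<le> damped_green n 0"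
proof -
  obtain m where "t mod (2 * int n) = int m" "m < 2 * n"
    by (rule double_mod_cases[OF assms])
  then show ?thesis
    using damped_profile_le[of 0 m n] assms by (simp add: damped_green_def cyclic_def)
qed

lemma damped_green_le_second:
  assumes "0 < n" "even t" "\<not> 2 * int n dvd t"
  shows "damped_green n t \<le> damped_green n 2"
proof -
  obtain m where m: "t mod (2 * int n) = int m" "m < 2 * n" "2 * int n dvd t \<longleftrightarrow> m = 0" "even t \<longleftrightarrow> even m"
    by (rule double_mod_cases[of n t]) (use assms in auto)
  have "2 \<le> m" "m + 2 \<le> 2 * n"
    using m assms by (auto elim!: evenE)
  then show ?thesis
    using damped_profile_le[of 2 m n] m assms(1)
    using cyclic_nat[of 2 "2 * n" "damped_profile n"]
    by (simp add: damped_green_def cyclic_def)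
qed

text \<open>Write g0, g2, g4 for the values at 0, 2, 4. Then 3 g0 = 1 + g2, and 6 g2 = g0 + g4 with
  g4 <= g2 gives 5 g2 <= g0. Together 14 g2 <= 1.\<close>

lemma damped_green_bounds:
  assumes "n \<ge> 3"
  shows "1 / 3 \<le> damped_green n 0" "damped_green n 0 \<le> 5 / 14" "damped_green n 2 \<le> 1 / 14"
    "3 * damped_green n 0 = 1 + damped_green n 2"
proof -
  have ndvd: "\<not> 2 * int n dvd 2" "\<not> 2 * int n dvd 4"
    using assms by (auto dest!: zdvd_imp_le)
  have rec0: "3 * damped_green n 0 = 1 + damped_green n 2"
    using damped_green_even_recurrence[of n 0] damped_green_minus[of n 2] assms by simp
  moreover have "6 * damped_green n 2 = damped_green n 0 + damped_green n 4"
    using damped_green_even_recurrence[of n 2] ndvd assms by simp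
  moreover have "damped_green n 4 \<le> damped_green n 2"
    using damped_green_le_second[of n 4] ndvd assms by simp
  moreover have "0 \<le> damped_green n 2"
    using damped_green_nonneg assms by simp
  ultimately show "1 / 3 \<le> damped_green n 0" "damped_green n 0 \<le> 5 / 14" "damped_green n 2 \<le> 1 / 14"
    "3 * damped_green n 0 = 1 + damped_green n 2"
    by linarith+
qed

lemma cycle_resistance_ge:
  assumes "0 < n" "t mod (2 * int n) = int m" "k \<le> m" "m + k \<le> 2 * n"
  shows "real k * (2 * real n - real k) / (2 * real n) \<le> cycle_resistance n t"
proof -
  \<comment> \<open>This product equals m (2n - m) - k (2n - k).\<close>
  have "0 \<le> (real m - real k) * (2 * real n - real m - real k)"
    using assms by (intro mult_nonneg_nonneg) auto
  then have "real k * (2 * real n - real k) \<le> real m * (2 * real n - real m)"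
    by (simp add: algebra_simps)
  then show ?thesis
    using assms by (simp add: cycle_resistance_def cyclic_def divide_right_mono)
qed

text \<open>The nearest nonzero even residue is 2; its value 2 (2n - 2) / (2n) grows with n and is
  4/3 at n = 3.\<close>

lemma cycle_resistance_even_ge:
  assumes "n \<ge> 3" "even t" "\<not> 2 * int n dvd t"
  shows "4 / 3 \<le> cycle_resistance n t"
proof -
  obtain m where m: "t mod (2 * int n) = int m" "m < 2 * n" "2 * int n dvd t \<longleftrightarrow> m = 0" "even t \<longleftrightarrow> even m"
    by (rule double_mod_cases[of n t]) (use assms in auto)
  have "2 \<le> m" "m + 2 \<le> 2 * n"
    using m assms by (auto elim!: evenE)
  then have "real 2 * (2 * real n - real 2) / (2 * real n) \<le> cycle_resistance n t"
    using assms(1) m by (intro cycle_resistance_ge) auto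
  moreover have "4 / 3 \<le> real 2 * (2 * real n - real 2) / (2 * real n)"
    using assms(1) by (simp add: field_simps)
  ultimately show ?thesis
    by (rule order_trans[rotated])
qed

lemma cycle_resistance_odd_ge:
  assumes "n \<ge> 3" "odd t"
  shows "5 / 6 \<le> cycle_resistance n t"
proof -
  obtain m where m: "t mod (2 * int n) = int m" "m < 2 * n" "2 * int n dvd t \<longleftrightarrow> m = 0" "even t \<longleftrightarrow> even m"
    by (rule double_mod_cases[of n t]) (use assms in auto)
  have "1 \<le> m" "m + 1 \<le> 2 * n"
    using m assms by (auto elim!: oddE)
  then have "real 1 * (2 * real n - real 1) / (2 * real n) \<le> cycle_resistance n t"
    using assms(1) m by (intro cycle_resistance_ge) auto
  moreover have "5 / 6 \<le> real 1 * (2 * real n - real 1) / (2 * real n)"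
    using assms(1) by (simp add: field_simps)
  ultimately show ?thesis
    by (rule order_trans[rotated])
qed

text \<open>The differences on the left shrink at least threefold at each step, while the bound on the right
  is \<open>1 / (2 n)\<close> times an integer \<open>k \<ge> 3\<close> that becomes \<open>k - 2 \<ge> k / 3\<close>.\<close>

lemma damped_green_decrease:
  assumes "n \<ge> 3" "2 * d + 1 < n"
  shows "damped_green n (2 * int d) - damped_green n (2 * int d + 2) \<le> (real n - 2 * d - 1) / (2 * n)"
  using assms(2)
proof (induction d)
  case 0
  \<comment> \<open>By 3 g0 = 1 + g2 the difference is 1 - 2 g0, and g0 >= 1/3.\<close>
  have "damped_green n 0 - damped_green n 2 \<le> 1 / 3"
    using damped_green_bounds[OF assms(1)] by linarith
  also have "\<dots> \<le> (real n - 1) / (2 * n)"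
    using assms(1) by (simp add: field_simps)
  finally show ?case
    by simp
next
  case (Suc d)
  have "\<not> 2 * int n dvd 2 * int (Suc d)"
    using Suc.prems by (auto dest!: zdvd_imp_le)
  then have "6 * damped_green n (2 * int d + 2) = damped_green n (2 * int d) + damped_green n (2 * int d + 4)"
    using damped_green_even_recurrence[of n "2 * int (Suc d)"] assms(1) by (simp add: algebra_simps)
  moreover have "0 \<le> damped_green n (2 * int d + 2)" "0 \<le> damped_green n (2 * int d + 4)"
    using assms(1) damped_green_nonneg by auto
  \<comment> \<open>After substituting the recurrence, the claim says that the sum of the two later
    values is nonnegative.\<close>
  ultimately have "damped_green n (2 * int d + 2) - damped_green n (2 * int d + 4)
      \<le> (damped_green n (2 * int d) - damped_green n (2 * int d + 2)) / 3"
    by (simp add: field_simps)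
  also have "\<dots> \<le> (real n - 2 * d - 1) / (2 * n) / 3"
    using Suc by (intro divide_right_mono) auto
  also have "\<dots> = (real n - 2 * d - 1) / 3 / (2 * n)"
    by simp
  also have "\<dots> \<le> (real n - 2 * Suc d - 1) / (2 * n)"
    using Suc.prems by (intro divide_right_mono) auto
  finally show ?case
    by (simp add: algebra_simps)
qed

text \<open>For a U-vertex and a V-vertex, twice the resistance is this quantity plus the constant 4
  gamma(0).\<close>

definition opposite_profile :: "nat \<Rightarrow> int \<Rightarrow> real" where
  "opposite_profile n t = cycle_resistance n t + 4 * damped_green n t"

lemma opposite_profile_mono:
  assumes "n \<ge> 3" "d \<le> e" "e \<le> n div 2"
  shows "opposite_profile n (2 * int d) \<le> opposite_profile n (2 * int e)"
  using assms(2,3)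
proof (induction e rule: dec_induct)
  case (step e)
  have c: "cycle_resistance n (2 * int k) = 2 * k * (real n - k) * 2 / (2 * n)" if "k < n" for k
    using cyclic_nat[of "2 * k" "2 * n"] that by (simp add: cycle_resistance_def algebra_simps)
  have "Suc e < n"
    using step.prems assms(1) by linarith
  \<comment> \<open>The growth of c is exactly four times the bound on the decrease of gamma, so c +
    4 gamma cannot drop.\<close>
  then have "cycle_resistance n (2 * int (Suc e)) - cycle_resistance n (2 * int e) = 4 * ((real n - 2 * e - 1) / (2 * n))"
    using c[of e] c[of "Suc e"] step assms(1) by (simp add: field_simps)
  moreover have "damped_green n (2 * int e) - damped_green n (2 * int e + 2) \<le> (real n - 2 * e - 1) / (2 * n)"
    using step.prems by (intro damped_green_decrease assms(1)) linarith
  moreover have "2 * int (Suc e) = 2 * int e + 2"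
    by simp
  ultimately have "opposite_profile n (2 * int e) \<le> opposite_profile n (2 * int (Suc e))"
    unfolding opposite_profile_def by (simp only:)
  then show ?case
    using step by simp
qed simp

lemma opposite_profile_cong:
  "s mod (2 * int n) = t mod (2 * int n) \<Longrightarrow> opposite_profile n s = opposite_profile n t"
  by (simp add: opposite_profile_def cycle_resistance_def damped_green_def cyclic_def)

lemma opposite_profile_le_max:
  assumes "n \<ge> 3" "even t"
  shows "opposite_profile n t \<le> opposite_profile n (2 * int (n div 2))"
proof -
  obtain m where m: "t mod (2 * int n) = int m" "m < 2 * n" "2 * int n dvd t \<longleftrightarrow> m = 0" "even t \<longleftrightarrow> even m"
    by (rule double_mod_cases[of n t]) (use assms in auto)
  obtain k where k: "m = 2 * k"
    using m assms(2) by blast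
  have t: "t mod (2 * int n) = 2 * int k" "k < n"
    using m k by auto
  show ?thesis
  proof (cases "k \<le> n div 2")
    case True
    have "opposite_profile n t = opposite_profile n (2 * int k)"
      using t by (intro opposite_profile_cong) simp
    then show ?thesis
      using opposite_profile_mono[OF assms(1) True] by simp
  next
    case False
    have "opposite_profile n t = opposite_profile n (- t)"
      using assms(1) by (simp add: opposite_profile_def damped_green_minus cycle_resistance_minus)
    \<comment> \<open>Reflection folds the far half of the cycle onto the near half, where
      monotonicity applies.\<close>
    also have "\<dots> = opposite_profile n (2 * int (n - k))"
      using t False by (intro opposite_profile_cong) (simp add: zmod_zminus1_eq_if of_nat_diff)
    finally show ?thesis
      using opposite_profile_mono[OF assms(1), of "n - k" "n div 2"] False t by simp
  qed
qed

text \<open>The left side is the average of the profile at t - 1 and t + 1, minus gamma at both,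
  plus 1 / (2n) - gamma(0). The last two terms sum to a negative number since gamma(0) >=
  1/3.\<close>

lemma opposite_profile_odd:
  assumes "n \<ge> 3" "odd t"
  shows "cycle_resistance n t + 2 * sqrt 2 * damped_green n t - damped_green n 0
    \<le> opposite_profile n (2 * int (n div 2))"
proof -
  have ndvd: "\<not> 2 * int n dvd t"
    using assms(2) by (meson dvd_mult_left)
  have "2 * cycle_resistance n t = cycle_resistance n (t - 1) + cycle_resistance n (t + 1) + 1 / n"
    using cycle_resistance_second_difference[of n t] ndvd assms(1) by simp
  moreover have "2 * sqrt 2 * damped_green n t = damped_green n (t - 1) + damped_green n (t + 1)"
    using damped_green_recurrence[of n t] ndvd assms(1) by simp
  moreover have "opposite_profile n (t - 1) \<le> opposite_profile n (2 * int (n div 2))"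
    "opposite_profile n (t + 1) \<le> opposite_profile n (2 * int (n div 2))"
    using assms by (auto intro!: opposite_profile_le_max)
  moreover have "1 / n \<le> 1 / (3 :: real)"
    using assms(1) by (simp add: field_simps)
  moreover have "1 / 3 \<le> damped_green n 0" "0 \<le> damped_green n (t - 1)" "0 \<le> damped_green n (t + 1)"
    using damped_green_bounds[OF assms(1)] damped_green_nonneg assms(1) by auto
  ultimately show ?thesis
    unfolding opposite_profile_def by linarith
qed

text \<open>At most one of t - 1 and t + 1 is a multiple of 2n, so their gamma values sum to at most
  5/14 + 1/14.\<close>

lemma damped_green_odd_bounds:
  assumes "n \<ge> 3" "odd t"
  shows "0 \<le> 2 * sqrt 2 * damped_green n t" "2 * sqrt 2 * damped_green n t \<le> 6 / 14"
proof -
  have ndvd: "\<not> 2 * int n dvd t"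
    using assms(2) by (meson dvd_mult_left)
  have eq: "2 * sqrt 2 * damped_green n t = damped_green n (t - 1) + damped_green n (t + 1)"
    using damped_green_recurrence[of n t] ndvd assms(1) by simp
  have "\<not> (2 * int n dvd t - 1 \<and> 2 * int n dvd t + 1)"
    using assms(1) dvd_diff[of "2 * int n" "t + 1" "t - 1"] zdvd_imp_le[of "2 * int n" 2] by auto
  then have "damped_green n (t - 1) \<le> damped_green n 2 \<or> damped_green n (t + 1) \<le> damped_green n 2"
    using damped_green_le_second[of n "t - 1"] damped_green_le_second[of n "t + 1"] assms by auto
  moreover have "damped_green n (t - 1) \<le> damped_green n 0" "damped_green n (t + 1) \<le> damped_green n 0"
    using damped_green_le_max assms(1) by auto
  ultimately show "2 * sqrt 2 * damped_green n t \<le> 6 / 14"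
    using damped_green_bounds[OF assms(1)] eq by linarith
  show "0 \<le> 2 * sqrt 2 * damped_green n t"
    using damped_green_nonneg[of n t] assms(1) by simp
qed

section \<open>Comparison of all pairs with the two extremal ones\<close>

theorem theorem4p4:
  fixes n :: nat and a b :: hex_vertex
  assumes "n \<ge> 3"
    and "a \<in> hex_cylinder_verts n" and "b \<in> hex_cylinder_verts n" and "a \<noteq> b"
  shows "hex_cylinder_resistance n (U 1) (V ((n + 2) div 2)) \<ge> hex_cylinder_resistance n a b \<and>
         hex_cylinder_resistance n a b \<ge> hex_cylinder_resistance n (P 1) (Q 1)"
proof -
  define t where "t = pos a - pos b"
  define X where "X = 2 * hex_cylinder_resistance n a b"
  define M where "M = opposite_profile n (2 * int (n div 2))"
  define g0 where "g0 = damped_green n 0"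
  have X: "X = cycle_resistance n t + ((weight a)\<^sup>2 + (weight b)\<^sup>2) * g0
    - 2 * side a * side b * weight a * weight b * damped_green n t"
    unfolding X_def t_def g0_def by (rule hex_cylinder_resistance_eq) (fact assms)+
  have g0: "1 / 3 \<le> g0" "g0 \<le> 5 / 14"
    using damped_green_bounds[OF assms(1)] by (auto simp: g0_def)
  \<comment> \<open>The position of \<open>U 1\<close> minus that of
    \<open>V ((n + 2) div 2)\<close> is -2 (n div 2).\<close>
  have "damped_green n (- (2 * int (n div 2))) = damped_green n (2 * int (n div 2))"
    "cycle_resistance n (- (2 * int (n div 2))) = cycle_resistance n (2 * int (n div 2))"
    using assms(1) by (auto intro: damped_green_minus cycle_resistance_minus)
  moreover have "U 1 \<in> hex_cylinder_verts n" "V ((n + 2) div 2) \<in> hex_cylinder_verts n"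
    using assms(1) by (auto simp: hex_cylinder_verts_def)
  ultimately have upper: "2 * hex_cylinder_resistance n (U 1) (V ((n + 2) div 2)) = M + 4 * g0"
    using hex_cylinder_resistance_eq[OF assms(1), of "U 1" "V ((n + 2) div 2)"]
    by (simp add: M_def opposite_profile_def g0_def)
  have "P 1 \<in> hex_cylinder_verts n" "Q 1 \<in> hex_cylinder_verts n"
    using assms(1) by (auto simp: hex_cylinder_verts_def)
  then have lower: "2 * hex_cylinder_resistance n (P 1) (Q 1) = 4 * g0"
    using hex_cylinder_resistance_eq[OF assms(1), of "P 1" "Q 1"]
    by (simp add: cycle_resistance_0 g0_def)
  have M: "cycle_resistance n s + 4 * damped_green n s \<le> M" if "even s" for s
    using opposite_profile_le_max[OF assms(1) that] by (simp add: M_def opposite_profile_def)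
  have side: "side a * side b = 1 \<or> side a * side b = - 1"
    by (cases a; cases b) auto
  have "4 * g0 \<le> X \<and> X \<le> M + 4 * g0"
  proof (cases "even t")
    case True
    then have w: "weight b = weight a" "(weight a)\<^sup>2 = 1 \<or> (weight a)\<^sup>2 = 2"
      by (cases a; cases b; simp add: t_def)+
    have X': "X = cycle_resistance n t + 2 * (weight a)\<^sup>2 * (g0 - side a * side b * damped_green n t)"
      unfolding X w(1) by (simp add: power2_eq_square algebra_simps)
    show ?thesis
    proof (cases "2 * int n dvd t")
      case dvd: True
      then have "pos a = pos b"
        using dvd_pos_diff_iff assms(2,3) unfolding t_def by blast
      then have "t = 0" "side a * side b = - 1"
        using assms(4) by (cases a; cases b; simp add: t_def; presburger)+
      \<comment> \<open>The two vertices face each other on different copies. The value is 4 g0 or 8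
        g0, and M >= 4 g0 because M bounds the profile at 0.\<close>
      then have "X = 4 * (weight a)\<^sup>2 * g0"
        using X' by (simp add: cycle_resistance_0 g0_def)
      then show ?thesis
        using w(2) g0 M[of 0] by (auto simp: cycle_resistance_0 g0_def)
    next
      case False
      have "damped_green n t \<le> 1 / 14"
        using damped_green_le_second[OF _ True False] damped_green_bounds[OF assms(1)] assms(1) by simp
      moreover have "0 \<le> damped_green n t"
        using damped_green_nonneg assms(1) by simp
      moreover note cycle_resistance_even_ge[OF assms(1) True False] M[OF True]
      \<comment> \<open>For the lower bound, c >= 4/3 outweighs the loss from gamma(t) <= 1/14 and,
        for weight 1, the missing 2 g0 <= 5/7.\<close>
      ultimately show ?thesis
        using side w(2) g0 unfolding X' by auto
    qed
  next
    case False
    then have "weight a * weight b = sqrt 2" "(weight a)\<^sup>2 + (weight b)\<^sup>2 = 3"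
      by (cases a; cases b; simp add: t_def)+
    moreover define y where "y = 2 * sqrt 2 * damped_green n t"
    ultimately have "X = cycle_resistance n t + 3 * g0 - side a * side b * y"
      unfolding X by (simp add: algebra_simps)
    \<comment> \<open>The lower bound needs g0 <= 5/6 - 6/14 = 17/42, which 5/14 satisfies; the
      upper bound is tightest on different copies.\<close>
    then show ?thesis
      using side g0 damped_green_odd_bounds[OF assms(1) False] cycle_resistance_odd_ge[OF assms(1) False]
        opposite_profile_odd[OF assms(1) False]
      unfolding M_def[symmetric] g0_def[symmetric] y_def[symmetric] by auto
  qed
  then show ?thesis
    using upper lower by (simp add: X_def)
qed

end
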